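(* Let $S^1$ be the circle of perimeter $1$, with points identified with their coordinates in $[0,1)$ (modulo $1$), and let $d(x,y)=\min(|x-y|,\,1-|x-y|)$ be the geodesic distance along the circle. Assume that the ground cost $c$ can be written $c(x,y)=h(d(x,y))$, where $h:\mathbb{R}\to\mathbb{R}^+$ is an increasing and convex function. Let $f=\sum_{i=1}^{N} f[i]\,\delta_{x_i}$ and $g=\sum_{j=1}^{M} g[j]\,\delta_{y_j}$ be two discrete probability distributions on the circle, with cumulative distribution functions $F$ and $G$ (extended to $\mathbb{R}$), and for $\alpha\in\mathbb{R}$ let $G^{\alpha}$ denote the function $G-\alpha$. Then $$\mathrm{MK}_c(f,g)=\inf_{\alpha\in\mathbb{R}}\int_0^1 h\big(\,|F^{-1}(u)-(G^{\alpha})^{-1}(u)|\,\big)\,du,$$ where $F^{-1}$ and $(G^\alpha)^{-1}$ denote pseudo-inverses and $\mathrm{MK}_c(f,g)$ is the optimal transportation cost between $f$ and $g$ for the ground cost $c$.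
   Context: Discrete distributions: $\{x_1,\dots,x_N\}$ and $\{y_1,\dots,y_M\}$ are finite sets of points on the circle, the masses $f[i]$, $g[j]$ are positive, and $\sum_{i=1}^N f[i]=\sum_{j=1}^M g[j]=1$. Here $\mathbb{R}^+=[0,\infty)$. Optimal transportation cost: $$\mathrm{MK}_c(f,g):=\min_{(\alpha_{i,j})\in\mathcal{M}}\ \sum_{i=1}^N\sum_{j=1}^M \alpha_{i,j}\,c(x_i,y_j),$$ where $\mathcal{M}$ is the set of real $N\times M$ matrices $(\alpha_{i,j})$ with $\alpha_{i,j}\ge 0$, $\sum_i\alpha_{i,j}=g[j]$ for all $j$, and $\sum_j\alpha_{i,j}=f[i]$ for all $i$. Cumulative distribution function: for $y\in[0,1)$, $F(y)=\sum_{i=1}^N f[i]\,\mathbf{1}_{\{x_i\in[0,y)\}}$, where $x_i$ is identified with its coordinate in $[0,1)$; $F$ is extended to all of $\mathbb{R}$ by $F(y+1)=F(y)+1$. $G$ is defined from $g$ in the same way. Pseudo-inverse: $F^{-1}(u)=\inf\{t\in\mathbb{R}:\ F(t)>u\}$, and likewise $(G^{\alpha})^{-1}(u)=\inf\{t\in\mathbb{R}:\ G(t)-\alpha>u\}$. *)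

theory Defs
  imports "HOL-Analysis.Analysis"
begin

text \<open>A point of the circle of perimeter 1 is represented by its coordinate in \<open>{0..<1}\<close>;
  the distance below is only meaningful for such coordinates.\<close>

definition circle_dist :: "real \<Rightarrow> real \<Rightarrow> real" where
  "circle_dist x y = min \<bar>x - y\<bar> (1 - \<bar>x - y\<bar>)"

text \<open>The distribution with mass \<open>f i\<close> at the point \<open>x i\<close>, for \<open>i \<in> {1..N}\<close>.
  Values of \<open>x\<close> and \<open>f\<close> at other indices are irrelevant here and in everything below.\<close>

definition discrete_distribution :: "nat \<Rightarrow> (nat \<Rightarrow> real) \<Rightarrow> (nat \<Rightarrow> real) \<Rightarrow> bool" where
  "discrete_distribution N x f \<longleftrightarrow>
     (\<forall>i\<in>{1..N}. x i \<in> {0..<1}) \<and> (\<forall>i\<in>{1..N}. f i > 0) \<and> (\<Sum>i=1..N. f i) = 1"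

definition transport_plans ::
    "nat \<Rightarrow> (nat \<Rightarrow> real) \<Rightarrow> nat \<Rightarrow> (nat \<Rightarrow> real) \<Rightarrow> (nat \<Rightarrow> nat \<Rightarrow> real) set" where
  "transport_plans N f M g =
     {a. (\<forall>i\<in>{1..N}. \<forall>j\<in>{1..M}. a i j \<ge> 0) \<and>
         (\<forall>j\<in>{1..M}. (\<Sum>i=1..N. a i j) = g j) \<and>
         (\<forall>i\<in>{1..N}. (\<Sum>j=1..M. a i j) = f i)}"

definition transport_cost ::
    "(real \<Rightarrow> real \<Rightarrow> real) \<Rightarrow> nat \<Rightarrow> (nat \<Rightarrow> real) \<Rightarrow> nat \<Rightarrow> (nat \<Rightarrow> real) \<Rightarrow>
     (nat \<Rightarrow> nat \<Rightarrow> real) \<Rightarrow> real" where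
  "transport_cost c N x M y a = (\<Sum>i=1..N. \<Sum>j=1..M. a i j * c (x i) (y j))"

text \<open>\<open>LEAST\<close> rather than \<open>Inf\<close>: the optimal cost is a minimum, so any equation determining its
  value has to establish that it is attained.\<close>

definition MK ::
    "(real \<Rightarrow> real \<Rightarrow> real) \<Rightarrow> nat \<Rightarrow> (nat \<Rightarrow> real) \<Rightarrow> (nat \<Rightarrow> real) \<Rightarrow>
     nat \<Rightarrow> (nat \<Rightarrow> real) \<Rightarrow> (nat \<Rightarrow> real) \<Rightarrow> real" where
  "MK c N x f M y g =
     (LEAST v. v \<in> transport_cost c N x M y ` transport_plans N f M g)"

text \<open>The sum is the distribution function on \<open>{0..<1}\<close>; it is evaluated at the fractional part,
  and adding the floor is its unique extension satisfying \<open>F (t + 1) = F t + 1\<close>. The half-open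
  interval makes it left-continuous.\<close>

definition circle_cdf :: "nat \<Rightarrow> (nat \<Rightarrow> real) \<Rightarrow> (nat \<Rightarrow> real) \<Rightarrow> real \<Rightarrow> real" where
  "circle_cdf N x f t =
     (\<Sum>i=1..N. f i * indicator {0..<frac t} (x i)) + of_int \<lfloor>t\<rfloor>"

definition pseudo_inverse :: "(real \<Rightarrow> real) \<Rightarrow> real \<Rightarrow> real" where
  "pseudo_inverse F u = Inf {t. F t > u}"

end

theory Submission
  imports Defs
begin

text \<open>
  Write \<open>Q\<close>, \<open>R\<close> for the pseudo-inverses of \<open>F\<close>, \<open>G\<close>; the pseudo-inverse of \<open>G - \<alpha>\<close> is \<open>R(u + \<alpha>)\<close>.
  For every \<open>\<alpha>\<close>, the pair \<open>(Q(u), R(u + \<alpha>))\<close> taken modulo 1, with \<open>u\<close> uniform on \<open>[0,1]\<close>, is a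
  transport plan whose cost is at most the integral, since \<open>d\<close> is dominated by distances of lifts.

  Conversely, let \<open>a\<close> be any plan. Choose integers \<open>k i j\<close> with
  \<open>d (x i) (y j) = \<bar>x i - (y j + k i j)\<bar>\<close> and put \<open>\<alpha> = \<Sum> a i j * k i j\<close>, the mean winding of the plan.
  Set \<open>H z = h \<bar>z\<bar>\<close>, which is convex. The periodic monotone coupling admits Kantorovich potentials
  \<open>p (s) + q (t) \<le> H (s - t)\<close> on the lifted points, with equality at \<open>s = Q(u)\<close>, \<open>t = R(u + \<alpha>)\<close>, and
  these are periodic up to a drift: \<open>p (s + 1) = p s + \<kappa>\<close>, \<open>q (t + 1) = q t - \<kappa>\<close>. Integrating along
  the coupling and summing against the plan gives the same quantity
  \<open>\<Sum> f i * p (x i) + \<Sum> g j * q (y j) - \<kappa> * \<alpha>\<close>, precisely by the choice of \<open>\<alpha>\<close>; hence the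
  integral for this \<open>\<alpha>\<close> is at most the cost of \<open>a\<close>.
\<close>

section \<open>Convexity, periodic integrals and optimal plans\<close>

text \<open>The points \<open>b - s\<close> and \<open>a - r\<close> are convex combinations of
  \<open>a - s\<close> and \<open>b - r\<close> with exchanged weights, so the weights cancel when
  the two convexity inequalities are added. This is the Monge property behind the optimality of
  monotone couplings.\<close>

lemma convex_increment_mono:
  fixes H :: "real \<Rightarrow> real"
  assumes "convex_on UNIV H" "a \<le> b" "r \<le> s"
  shows "H (b - s) - H (a - s) \<le> H (b - r) - H (a - r)"
proof (cases "a = b \<or> r = s")
  case False
  define l where "l = (b - a) / ((b - a) + (s - r))"
  have pos: "0 < (b - a) + (s - r)" using assms False by simp
  then have l: "0 \<le> l" "l \<le> 1" and l': "l * ((b - a) + (s - r)) = b - a"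
    using assms by (auto simp: l_def divide_simps)
  have 1: "b - s = (1 - l) * (a - s) + l * (b - r)"
    using l' by (simp add: algebra_simps)
  have 2: "a - r = (1 - (1 - l)) * (a - s) + (1 - l) * (b - r)"
    using l' by (simp add: algebra_simps)
  have "H (b - s) \<le> (1 - l) * H (a - s) + l * H (b - r)"
    using convex_onD[OF assms(1) l(1,2), of "a - s" "b - r"] unfolding 1 by simp
  moreover have "H (a - r) \<le> (1 - (1 - l)) * H (a - s) + (1 - l) * H (b - r)"
    using convex_onD[OF assms(1), of "1 - l" "a - s" "b - r"] l unfolding 2 by simp
  ultimately show ?thesis
    by (simp add: algebra_simps)
qed auto

lemma convex_on_mono_abs:
  fixes h :: "real \<Rightarrow> real"
  assumes "mono h" "convex_on UNIV h"
  shows "convex_on UNIV (\<lambda>z. h \<bar>z\<bar>)"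
proof (intro convex_onI)
  fix t y z :: real
  assume t: "0 < t" "t < 1"
  have "\<bar>(1 - t) * y + t * z\<bar> \<le> (1 - t) * \<bar>y\<bar> + t * \<bar>z\<bar>"
    using t abs_triangle_ineq[of "(1 - t) * y" "t * z"] by (simp add: abs_mult)
  then have "h \<bar>(1 - t) * y + t * z\<bar> \<le> h ((1 - t) * \<bar>y\<bar> + t * \<bar>z\<bar>)"
    using assms(1) by (rule monoD[rotated])
  also have "\<dots> \<le> (1 - t) * h \<bar>y\<bar> + t * h \<bar>z\<bar>"
    using convex_onD[OF assms(2), of t "\<bar>y\<bar>" "\<bar>z\<bar>"] t by simp
  finally show "h \<bar>(1 - t) *\<^sub>R y + t *\<^sub>R z\<bar> \<le> (1 - t) * h \<bar>y\<bar> + t * h \<bar>z\<bar>"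
    by simp
qed auto

text \<open>For an antiderivative \<open>J\<close> of \<open>w\<close>, the quantity
  \<open>J (t + 1) - J t - k * t\<close> is independent of \<open>t\<close>; comparing
  \<open>t = a\<close> with \<open>t = 0\<close> gives the excess \<open>k * a\<close>.\<close>

lemma has_integral_shift_quasi_periodic:
  fixes w :: "real \<Rightarrow> real"
  assumes per: "\<And>u. w (u + 1) = w u + k"
    and int: "\<And>a b. w integrable_on {a..b}"
    and w: "(w has_integral I) {0..1}"
  shows "((\<lambda>u. w (u + a)) has_integral (I + k * a)) {0..1}"
proof -
  \<comment> \<open>The base point \<open>b\<close> of \<open>J\<close> lies to the left of both
    \<open>0\<close> and \<open>a\<close>, so one computation covers both signs of
    \<open>a\<close>.\<close>
  define n where "n = nat (\<lceil>\<bar>a\<bar>\<rceil>) + 1"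
  define b where "b = - real n"
  have b: "b \<le> a" "b \<le> 0"
    unfolding b_def n_def by linarith+
  define J where "J t = integral {b..t} w" for t
  have split: "integral {s..t} w = J t - J s" if "b \<le> s" "s \<le> t" for s t
    using Henstock_Kurzweil_Integration.integral_combine[OF that int] by (simp add: J_def)
  have shift: "integral {s + 1..t + 1} w = integral {s..t} w + k * (t - s)" if "s \<le> t" for s t
  proof -
    have "((\<lambda>u. w (u + 1)) has_integral integral {s..t} w + k * (t - s)) {s..t}"
      unfolding per using has_integral_add[OF integrable_integral[OF int] has_integral_const_real[of k s t]] that
      by (simp add: mult.commute)
    moreover have "((\<lambda>u. w (u + 1)) has_integral integral {s + 1..t + 1} w) {s..t}"
      using has_integral_affinity'[OF integrable_integral[OF int[of "s + 1" "t + 1"], folded box_real], of 1 1]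
      by simp
    ultimately show ?thesis
      by (rule has_integral_unique[rotated])
  qed
  have "J (a + 1) - J (b + 1) = J a - J b + k * (a - b)"
    using shift[of b a] split[of "b + 1" "a + 1"] split[of b a] b by simp
  moreover have "J 1 - J (b + 1) = J 0 - J b + k * (0 - b)"
    using shift[of b 0] split[of "b + 1" 1] split[of b 0] b by simp
  moreover have "J 1 - J 0 = I"
    using split[of 0 1] integral_unique[OF w] b by simp
  ultimately have "J (a + 1) - J a = I + k * a"
    by (simp add: algebra_simps)
  moreover have "((\<lambda>u. w (u + a)) has_integral integral {a..a + 1} w) {0..1}"
    using has_integral_affinity'[OF integrable_integral[OF int[of a "a + 1"], folded box_real], of 1 a]
    by simp
  ultimately show ?thesis
    using split[of a "a + 1"] b by simp
qed

text \<open>Monotonicity makes every joint level set of \<open>A\<close> and \<open>B\<close> an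
  interval, so the integrand is a finite combination of indicators of bounded intervals. Pairs of
  quantile functions have this form.\<close>

lemma integrable_mono_step:
  fixes A B :: "real \<Rightarrow> real" and p :: "real \<Rightarrow> real \<Rightarrow> real"
  assumes "mono A" "finite (A ` {a..b})" "mono B" "finite (B ` {a..b})"
  shows "(\<lambda>u. p (A u) (B u)) integrable_on {a..b}"
proof -
  define S where "S s t = {u \<in> {a..b}. A u = s \<and> B u = t}" for s t
  have "S s t \<in> lmeasurable" for s t
  proof (rule measurable_convex)
    have "is_interval (S s t)"
      unfolding is_interval_1
    proof safe
      fix u v w assume *: "u \<in> S s t" "v \<in> S s t" "u \<le> w" "w \<le> v"
      then have "A u \<le> A w" "A w \<le> A v" "B u \<le> B w" "B w \<le> B v"
        using assms by (auto dest: monoD)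
      then show "w \<in> S s t"
        using * by (auto simp: S_def)
    qed
    then show "convex (S s t)"
      by (rule is_interval_convex)
    show "bounded (S s t)"
      by (rule bounded_subset[of "{a..b}"]) (auto simp: S_def)
  qed
  then have "(\<lambda>u. 1::real) integrable_on S s t" for s t
    by (simp add: lmeasurable_iff_integrable_on)
  moreover have "S s t \<subseteq> {a..b}" for s t
    by (auto simp: S_def)
  ultimately have "(\<lambda>u. if u \<in> S s t then 1 else 0 :: real) integrable_on {a..b}" for s t
    by (simp add: integrable_on_def has_integral_restrict)
  then have "(\<lambda>u. \<Sum>s\<in>A ` {a..b}. \<Sum>t\<in>B ` {a..b}. p s t * (if u \<in> S s t then 1 else 0)) integrable_on {a..b}"
    by (intro integrable_sum assms integrable_on_mult_right)
  then show ?thesis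
  proof (rule integrable_eq)
    fix u assume u: "u \<in> {a..b}"
    have "(\<Sum>s\<in>A ` {a..b}. \<Sum>t\<in>B ` {a..b}. p s t * (if u \<in> S s t then 1 else 0))
        = (\<Sum>s\<in>A ` {a..b}. if A u = s then (\<Sum>t\<in>B ` {a..b}. if B u = t then p s t else 0) else 0)"
      using u by (intro sum.cong refl) (auto simp: S_def intro!: sum.cong)
    also have "\<dots> = p (A u) (B u)"
      using u assms by simp
    finally show "(\<Sum>s\<in>A ` {a..b}. \<Sum>t\<in>B ` {a..b}. p s t * (if u \<in> S s t then 1 else 0)) = p (A u) (B u)" .
  qed
qed

section \<open>Sequences indexed by the integers\<close>

lemma strict_mono_int:
  fixes xi :: "int \<Rightarrow> 'a :: order"
  assumes "\<And>n. xi n < xi (n + 1)"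
  shows "strict_mono xi"
proof (rule strict_monoI)
  fix m n :: int
  assume "m < n"
  then show "xi m < xi n"
  proof (induction n rule: int_gr_induct)
    case (step i)
    then show ?case using assms[of i] by simp
  qed (rule assms)
qed

text \<open>The witness sums \<open>d\<close> from \<open>0\<close> up to \<open>n\<close>, with the
  opposite sign below \<open>0\<close>; at most one of its two sums is nonempty.\<close>

lemma int_antidifference:
  fixes d :: "int \<Rightarrow> real"
  obtains P where "\<And>n. P (n + 1) = P n + d n"
proof
  fix n :: int
  define P where "P n = (\<Sum>l\<in>{0..<n}. d l) - (\<Sum>l\<in>{n..<0}. d l)" for n
  show "P (n + 1) = P n + d n"
  proof (cases "0 \<le> n")
    case True
    then have "{0..<n+1} = insert n {0..<n}" by auto
    then show ?thesis using True by (simp add: P_def)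
  next
    case False
    then have "{n..<0} = insert n {n+1..<0}" by auto
    then show ?thesis using False by (simp add: P_def)
  qed
qed

section \<open>Geodesic distance and lifts to the line\<close>

text \<open>Equal integer parts leave the direct arc, of length \<open>\<bar>s - t\<bar>\<close>.
  Otherwise they differ by at least 1, and the triangle inequality bounds the complementary
  arc.\<close>

lemma circle_dist_frac_le: "circle_dist (frac s) (frac t) \<le> \<bar>s - t\<bar>"
proof (cases "\<lfloor>s\<rfloor> = \<lfloor>t\<rfloor>")
  case True
  then show ?thesis by (simp add: circle_dist_def frac_def)
next
  case False
  then have "1 \<le> \<bar>real_of_int \<lfloor>s\<rfloor> - real_of_int \<lfloor>t\<rfloor>\<bar>"
    by linarith
  then have "1 - \<bar>frac s - frac t\<bar> \<le> \<bar>s - t\<bar>"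
    unfolding frac_def by linarith
  then show ?thesis by (simp add: circle_dist_def)
qed

text \<open>\<open>k\<close> records which arc is shorter: \<open>0\<close> for the direct one,
  \<open>1\<close> or \<open>-1\<close> for the one that wraps around.\<close>

lemma circle_dist_lift:
  assumes "s \<in> {0..<1}" "t \<in> {0..<1}"
  obtains k :: int where "circle_dist s t = \<bar>s - (t + of_int k)\<bar>"
proof -
  consider "\<bar>s - t\<bar> \<le> 1/2" | "s - t > 1/2" | "t - s > 1/2" by linarith
  then show ?thesis
  proof cases
    case 1
    then show ?thesis by (intro that[of 0]) (simp add: circle_dist_def)
  next
    case 2
    then show ?thesis using assms by (intro that[of 1]) (simp add: circle_dist_def)
  next
    case 3
    then show ?thesis using assms by (intro that[of "-1"]) (simp add: circle_dist_def)
  qed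
qed

section \<open>Existence of an optimal plan\<close>

text \<open>The plans form a compact set, nonempty because of the product plan
  \<open>f i * g j\<close>, on which the cost is continuous.\<close>

lemma transport_cost_attains_min:
  assumes f: "discrete_distribution N x f" and g: "discrete_distribution M y g"
  obtains a where "a \<in> transport_plans N f M g"
    "\<And>b. b \<in> transport_plans N f M g \<Longrightarrow> transport_cost c N x M y a \<le> transport_cost c N x M y b"
proof -
  have f': "\<And>i. i \<in> {1..N} \<Longrightarrow> 0 < f i" "(\<Sum>i=1..N. f i) = 1"
    and g': "\<And>j. j \<in> {1..M} \<Longrightarrow> 0 < g j" "(\<Sum>j=1..M. g j) = 1"
    using f g by (auto simp: discrete_distribution_def)
  define I where "I = {1..N} \<times> {1..M}"
  \<comment> \<open>Entries outside the index rectangle are pinned to \<open>0\<close>, so that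
    plans become points of a product of compact sets; entries inside are at most 1 because row
    \<open>i\<close> sums to \<open>f i\<close>.\<close>
  define K where "K = (Pi\<^sub>E UNIV (\<lambda>p. if p \<in> I then {0..1::real} else {0}))"
  define C where "C = {q :: nat \<times> nat \<Rightarrow> real. (\<forall>j\<in>{1..M}. (\<Sum>i=1..N. q (i, j)) = g j) \<and>
         (\<forall>i\<in>{1..N}. (\<Sum>j=1..M. q (i, j)) = f i)}"
  have "compactin (product_topology (\<lambda>_. euclidean) UNIV) K"
    unfolding K_def by (auto simp: compactin_PiE)
  then have "compact K"
    by (simp add: euclidean_product_topology)
  moreover have "closed C"
  proof -
    have "C = (\<Inter>j\<in>{1..M}. {q. (\<Sum>i=1..N. q (i, j)) = g j}) \<inter> (\<Inter>i\<in>{1..N}. {q. (\<Sum>j=1..M. q (i, j)) = f i})"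
      by (auto simp: C_def)
    also have "closed \<dots>"
      by (intro closed_Int closed_INT ballI closed_Collect_eq continuous_intros continuous_on_product_coordinates)
    finally show ?thesis .
  qed
  ultimately have comp: "compact (K \<inter> C)"
    by (rule compact_Int_closed)
  have plan: "(\<lambda>p. if p \<in> I then a (fst p) (snd p) else 0) \<in> K \<inter> C"
    if a: "a \<in> transport_plans N f M g" for a
  proof
    have "a i j \<le> 1" if "i \<in> {1..N}" "j \<in> {1..M}" for i j
    proof -
      have "a i j \<le> (\<Sum>j=1..M. a i j)"
        using a that by (intro member_le_sum) (auto simp: transport_plans_def)
      also have "\<dots> = f i"
        using a that by (auto simp: transport_plans_def)
      also have "f i \<le> (\<Sum>i=1..N. f i)"
        using that f' by (intro member_le_sum) (auto intro: less_imp_le)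
      finally show ?thesis using f' by simp
    qed
    then show "(\<lambda>p. if p \<in> I then a (fst p) (snd p) else 0) \<in> K"
      using a by (auto simp: K_def I_def transport_plans_def)
    show "(\<lambda>p. if p \<in> I then a (fst p) (snd p) else 0) \<in> C"
      using a by (auto simp: C_def I_def transport_plans_def)
  qed
  have "(\<lambda>i j. f i * g j) \<in> transport_plans N f M g"
    using f' g' by (auto simp: transport_plans_def less_imp_le simp flip: sum_distrib_left sum_distrib_right)
  then have "K \<inter> C \<noteq> {}"
    using plan by blast
  moreover have "continuous_on (K \<inter> C) (\<lambda>q. \<Sum>i=1..N. \<Sum>j=1..M. q (i, j) * c (x i) (y j))"
    by (intro continuous_intros continuous_on_subset[OF continuous_on_product_coordinates]) auto
  ultimately obtain q where q: "q \<in> K \<inter> C"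
    and q_min: "\<And>r. r \<in> K \<inter> C \<Longrightarrow> (\<Sum>i=1..N. \<Sum>j=1..M. q (i, j) * c (x i) (y j))
      \<le> (\<Sum>i=1..N. \<Sum>j=1..M. r (i, j) * c (x i) (y j))"
    using continuous_attains_inf[OF comp] by blast
  show ?thesis
  proof
    have "0 \<le> q (i, j)" if "i \<in> {1..N}" "j \<in> {1..M}" for i j
      using q that by (auto simp: K_def I_def dest!: PiE_mem[of _ _ _ "(i, j)"])
    then show "(\<lambda>i j. q (i, j)) \<in> transport_plans N f M g"
      using q by (auto simp: C_def transport_plans_def)
    fix b assume b: "b \<in> transport_plans N f M g"
    show "transport_cost c N x M y (\<lambda>i j. q (i, j)) \<le> transport_cost c N x M y b"
      using q_min[OF plan[OF b]] by (auto simp: transport_cost_def I_def)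
  qed
qed


section \<open>Quantiles of a distribution on the circle\<close>

locale circle_distribution =
  fixes N :: nat and x f :: "nat \<Rightarrow> real"
  assumes distribution: "discrete_distribution N x f"
begin

abbreviation F :: "real \<Rightarrow> real" where
  "F \<equiv> circle_cdf N x f"

abbreviation Q :: "real \<Rightarrow> real" where
  "Q \<equiv> pseudo_inverse F"

lemma x_ge_0: "i \<in> {1..N} \<Longrightarrow> 0 \<le> x i"
  and x_less_1: "i \<in> {1..N} \<Longrightarrow> x i < 1"
  and f_pos: "i \<in> {1..N} \<Longrightarrow> 0 < f i"
  and sum_f: "(\<Sum>i=1..N. f i) = 1"
  using distribution by (auto simp: discrete_distribution_def)

lemma f_nonneg: "i \<in> {1..N} \<Longrightarrow> 0 \<le> f i"
  using f_pos[of i] by simp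

lemma N_pos: "1 \<le> N"
  using sum_f by (cases N) auto

lemma cdf_add_int: "F (t + of_int k) = F t + of_int k"
  by (simp add: circle_cdf_def frac_def)

lemma cdf_unit:
  assumes "0 \<le> t" "t \<le> 1"
  shows "F t = (\<Sum>i\<in>{i\<in>{1..N}. x i < t}. f i)"
\<comment> \<open>At \<open>t = 1\<close> the sum is evaluated at \<open>frac 1 = 0\<close> and
  vanishes; the floor supplies the total mass instead.\<close>
proof (cases "t = 1")
  case True
  have "{i\<in>{1..N}. x i < t} = {1..N}"
    using x_less_1 True by auto
  then show ?thesis
    using True sum_f by (simp add: circle_cdf_def)
next
  case False
  then have "frac t = t" "\<lfloor>t\<rfloor> = 0"
    using assms by (auto simp: frac_eq floor_eq_iff)
  then have "F t = (\<Sum>i=1..N. f i * indicator {0..<t} (x i))"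
    unfolding circle_cdf_def by simp
  also have "\<dots> = (\<Sum>i=1..N. if x i < t then f i else 0)"
    using x_ge_0 by (intro sum.cong) (auto simp: indicator_def)
  also have "\<dots> = (\<Sum>i\<in>{i\<in>{1..N}. x i < t}. f i)"
    by (rule sum.inter_filter[symmetric]) simp
  finally show ?thesis .
qed

text \<open>\<open>v\<close> is the first atom at which the closed cumulative mass exceeds
  \<open>u\<close>. Since \<open>F\<close> is a left-continuous step function, it exceeds
  \<open>u\<close> exactly to the right of \<open>v\<close>.\<close>

lemma quantile_unit:
  assumes "0 \<le> u" "u < 1"
  obtains v where "v \<in> x ` {1..N}" "\<And>t. u < F t \<longleftrightarrow> v < t"
proof -
  define P where "P v = (\<Sum>i\<in>{i\<in>{1..N}. x i \<le> v}. f i)" for v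
  define V where "V = {v \<in> x ` {1..N}. u < P v}"
  have "{i\<in>{1..N}. x i \<le> Max (x ` {1..N})} = {1..N}"
    by auto
  moreover have "Max (x ` {1..N}) \<in> x ` {1..N}"
    using N_pos by (intro Max_in) auto
  ultimately have "Max (x ` {1..N}) \<in> V"
    using sum_f assms by (auto simp: V_def P_def)
  moreover have "finite V"
    by (simp add: V_def)
  ultimately have v: "Min V \<in> V" and v_le: "\<And>w. w \<in> V \<Longrightarrow> Min V \<le> w"
    by (metis Min_in empty_iff, simp)
  have v01: "0 \<le> Min V" "Min V < 1"
    using v x_ge_0 x_less_1 by (auto simp: V_def)
  have "u < F t \<longleftrightarrow> Min V < t" for t
  proof
    assume t: "Min V < t"
    show "u < F t"
    proof (cases "t < 1")
      case True
      have "P (Min V) \<le> F t"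
        using True v01 t unfolding P_def by (subst cdf_unit) (auto intro!: sum_mono2 f_nonneg)
      then show ?thesis
        using v by (auto simp: V_def)
    next
      case False
      then have "1 \<le> real_of_int \<lfloor>t\<rfloor>"
        by (simp add: le_floor_iff)
      moreover have "0 \<le> (\<Sum>i=1..N. f i * indicator {0..<frac t} (x i))"
        using f_nonneg by (intro sum_nonneg mult_nonneg_nonneg) auto
      ultimately show ?thesis
        using assms unfolding circle_cdf_def by linarith
    qed
  next
    assume u: "u < F t"
    show "Min V < t"
    proof (rule ccontr)
      assume "\<not> Min V < t"
      then have t: "t \<le> Min V" by simp
      show False
      proof (cases "t < 0")
        case True
        then have "\<lfloor>t\<rfloor> \<le> -1"
          by linarith
        then have "real_of_int \<lfloor>t\<rfloor> \<le> -1"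
          by linarith
        moreover have "(\<Sum>i=1..N. f i * indicator {0..<frac t} (x i)) \<le> (\<Sum>i=1..N. f i)"
          using f_nonneg by (intro sum_mono) (auto simp: indicator_def)
        ultimately show False
          using u assms sum_f unfolding circle_cdf_def by linarith
      next
        case False
        \<comment> \<open>If some atom precedes \<open>t\<close>, then \<open>F t\<close> is the
          closed mass up to the last such atom, which would lie in \<open>V\<close> below its
          minimum.\<close>
        define W where "W = {w \<in> x ` {1..N}. w < t}"
        have F: "F t = (\<Sum>i\<in>{i\<in>{1..N}. x i < t}. f i)"
          using False t v01 by (intro cdf_unit) auto
        show False
        proof (cases "W = {}")
          case True
          then have *: "{i\<in>{1..N}. x i < t} = {}"
            by (auto simp: W_def)
          show ?thesis
            using u assms unfolding F * by simp
        next
          case nonempty: False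
          have fW: "finite W"
            by (simp add: W_def)
          have "Max W \<in> W"
            using fW nonempty by (rule Max_in)
          moreover have "x i < t \<longleftrightarrow> x i \<le> Max W" if "i \<in> {1..N}" for i
            using that fW \<open>Max W \<in> W\<close> by (auto simp: W_def intro!: Max_ge)
          then have "F t = P (Max W)"
            unfolding F P_def by (intro sum.cong) auto
          ultimately have "Max W \<in> V"
            using u by (auto simp: V_def W_def)
          then show False
            using v_le[of "Max W"] \<open>Max W \<in> W\<close> t by (auto simp: W_def)
        qed
      qed
    qed
  qed
  then show ?thesis
    using v by (intro that[of "Min V"]) (auto simp: V_def)
qed

text \<open>Quasi-periodicity of \<open>F\<close> reduces to \<open>frac u\<close>. The superlevel
  set is then an open ray starting at a lifted atom, so its infimum is that atom and the equivalence
  with \<open>Q u < t\<close> is exact.\<close>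

lemma quantile:
  obtains i where "i \<in> {1..N}" "Q u = x i + of_int \<lfloor>u\<rfloor>" "\<And>t. u < F t \<longleftrightarrow> Q u < t"
proof -
  obtain v where v: "v \<in> x ` {1..N}" "\<And>t. frac u < F t \<longleftrightarrow> v < t"
    using quantile_unit[of "frac u"] by (auto simp: frac_lt_1)
  have *: "u < F t \<longleftrightarrow> v + of_int \<lfloor>u\<rfloor> < t" for t
    using v(2)[of "t - of_int \<lfloor>u\<rfloor>"] cdf_add_int[of t "- \<lfloor>u\<rfloor>"]
    by (auto simp: frac_def)
  then have "Q u = v + of_int \<lfloor>u\<rfloor>"
    by (simp add: pseudo_inverse_def flip: greaterThan_def)
  with v(1) * show ?thesis
    by (auto intro: that)
qed

lemma less_cdf_iff: "u < F t \<longleftrightarrow> Q u < t"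
  by (rule quantile[of u]) auto

lemma quantile_in: "\<exists>i\<in>{1..N}. Q u = x i + of_int \<lfloor>u\<rfloor>"
  by (rule quantile[of u]) auto

lemma quantile_mono: "u \<le> v \<Longrightarrow> Q u \<le> Q v"
  by (metis less_cdf_iff not_le order.strict_trans1 less_irrefl)

lemma quantile_add_int: "Q (u + of_int k) = Q u + of_int k"
proof -
  have "Q (u + of_int k) < t \<longleftrightarrow> Q u + of_int k < t" for t
    using cdf_add_int[of t "- k"]
    by (auto simp flip: less_cdf_iff less_diff_eq)
  then show ?thesis
    by (meson less_irrefl linorder_less_linear)
qed

text \<open>Since \<open>f i\<close> is positive, \<open>F\<close> jumps immediately to the right of
  \<open>x i\<close>. Hence every lifted atom is a value of \<open>Q\<close>.\<close>

lemma quantile_cdf: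
  assumes "i \<in> {1..N}"
  shows "Q (F (x i)) = x i"
proof (rule antisym)
  show "x i \<le> Q (F (x i))"
    using less_cdf_iff[of "F (x i)" "x i"] by simp
  show "Q (F (x i)) \<le> x i"
  proof (rule dense_ge_bounded[OF x_less_1[OF assms]])
    fix t assume t: "x i < t" "t < 1"
    have i: "0 \<le> x i" using x_ge_0[OF assms] .
    have "F (x i) < F t"
      using t i assms f_pos f_nonneg
      by (simp add: cdf_unit) (intro sum_strict_mono2[where b = i], auto)
    then show "Q (F (x i)) \<le> t"
      using less_cdf_iff by (simp add: less_imp_le)
  qed
qed

lemma quantile_surj:
  assumes "i \<in> {1..N}"
  obtains u where "Q u = x i + of_int k"
  using quantile_add_int[of "F (x i)" k] quantile_cdf[OF assms] that by simp

section \<open>Integration along the quantile function\<close>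

text \<open>\<open>Q\<close> takes the value \<open>s\<close> between the levels \<open>F s\<close>
  and \<open>F (nxt s)\<close>, whose difference is the mass of the atom \<open>s\<close>.\<close>

lemma has_integral_quantile:
  fixes p :: "real \<Rightarrow> real"
  shows "((\<lambda>u. p (Q u)) has_integral (\<Sum>i=1..N. f i * p (x i))) {0..1}"
proof -
  define X where "X = x ` {1..N}"
  \<comment> \<open>The inserted \<open>1\<close> serves as the right neighbour of the last
    atom.\<close>
  define nxt where "nxt s = Min (insert 1 {v \<in> X. s < v})" for s
  have nxt: "s < nxt s" "nxt s \<le> 1" "\<And>v. v \<in> X \<Longrightarrow> v < nxt s \<longleftrightarrow> v \<le> s" "0 \<le> s"
    if "s \<in> X" for s
  proof -
    have fin: "finite {v \<in> X. s < v}" by (simp add: X_def)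
    have "s < 1" using that x_less_1 by (auto simp: X_def)
    then show 1: "s < nxt s"
      using fin by (auto simp: nxt_def)
    show "nxt s \<le> 1"
      using fin by (auto simp: nxt_def)
    show "v < nxt s \<longleftrightarrow> v \<le> s" if "v \<in> X" for v
    proof
      assume "v < nxt s"
      then show "v \<le> s" using fin that by (auto simp: nxt_def not_less[symmetric])
    qed (use 1 in simp)
    show "0 \<le> s" using that x_ge_0 by (auto simp: X_def)
  qed
  have mass: "F (nxt s) - F s = (\<Sum>i\<in>{i\<in>{1..N}. x i = s}. f i)" if s: "s \<in> X" for s
  proof -
    have "F (nxt s) = (\<Sum>i\<in>{i\<in>{1..N}. x i \<le> s}. f i)"
      using nxt(1,2,4)[OF s] nxt(3)[OF s]
      by (subst cdf_unit) (auto simp: X_def intro!: sum.cong)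
    also have "\<dots> = (\<Sum>i\<in>{i\<in>{1..N}. x i < s} \<union> {i\<in>{1..N}. x i = s}. f i)"
      by (intro sum.cong) auto
    also have "\<dots> = F s + (\<Sum>i\<in>{i\<in>{1..N}. x i = s}. f i)"
      using nxt(1,2,4)[OF s] by (subst sum.union_disjoint) (auto simp: cdf_unit)
    finally show ?thesis by simp
  qed
  have mass_nonneg: "F s \<le> F (nxt s)" if s: "s \<in> X" for s
    using mass[OF s] sum_nonneg[of "{i\<in>{1..N}. x i = s}" f] f_nonneg by simp
  have "((\<lambda>u. \<Sum>s\<in>X. p s * indicator {F s..F (nxt s)} u) has_integral
      (\<Sum>s\<in>X. p s * (F (nxt s) - F s))) {0..1}"
  proof (intro has_integral_sum has_integral_mult_right)
    show "finite X" by (simp add: X_def)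
    fix s assume s: "s \<in> X"
    have "0 \<le> F s"
      using nxt(1,2,4)[OF s] f_nonneg by (subst cdf_unit) (auto intro!: sum_nonneg)
    moreover have "F (nxt s) \<le> (\<Sum>i=1..N. f i)"
      using nxt(1,2,4)[OF s] f_nonneg by (subst cdf_unit) (auto intro!: sum_mono2)
    ultimately have "{F s..F (nxt s)} \<subseteq> {0..1}"
      using sum_f by auto
    then have "((\<lambda>u. if u \<in> {F s..F (nxt s)} then 1 else 0) has_integral (F (nxt s) - F s)) {0..1::real}"
      using has_integral_const_real[of "1::real" "F s" "F (nxt s)"] mass_nonneg[OF s]
      by (subst has_integral_restrict) auto
    then show "(indicator {F s..F (nxt s)} has_integral (F (nxt s) - F s)) {0..1::real}"
      by (simp add: indicator_def[abs_def] of_bool_def)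
  qed
  also have "(\<Sum>s\<in>X. p s * (F (nxt s) - F s)) = (\<Sum>s\<in>X. \<Sum>i\<in>{i\<in>{1..N}. x i = s}. f i * p (x i))"
    by (intro sum.cong) (auto simp: mass sum_distrib_left mult.commute intro!: sum.cong)
  also have "\<dots> = (\<Sum>i=1..N. f i * p (x i))"
    unfolding X_def by (intro sum.group) auto
  finally show ?thesis
  proof (rule has_integral_spike_finite[rotated 2])
    \<comment> \<open>At the levels \<open>F (nxt s)\<close> the closed intervals may meet, and at
      \<open>u = 1\<close> the quantile enters the next period; these points are discarded.\<close>
    show "finite (insert 1 (F ` nxt ` X))" by (simp add: X_def)
    fix u assume u: "u \<in> {0..1} - insert 1 (F ` nxt ` X)"
    then have "\<lfloor>u\<rfloor> = 0"
      by (auto simp: floor_eq_iff)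
    then have Q: "Q u \<in> X"
      using quantile_in[of u] by (auto simp: X_def)
    have "indicator {F s..F (nxt s)} u = (if s = Q u then 1 else 0 :: real)" if s: "s \<in> X" for s
    proof -
      have "u \<in> {F s..F (nxt s)} \<longleftrightarrow> F s \<le> u \<and> u < F (nxt s)"
        using u s by auto
      also have "\<dots> \<longleftrightarrow> s = Q u"
        unfolding less_cdf_iff not_less[symmetric] using nxt(3)[OF s Q] by auto
      finally show ?thesis by (simp add: indicator_def)
    qed
    then have "(\<Sum>s\<in>X. p s * indicator {F s..F (nxt s)} u) = (\<Sum>s\<in>X. if s = Q u then p s else 0)"
      by (intro sum.cong) auto
    also have "\<dots> = p (Q u)"
      using Q by (simp add: X_def)
    finally show "p (Q u) = (\<Sum>s\<in>X. p s * indicator {F s..F (nxt s)} u)" by simp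
  qed
qed

lemma finite_quantile_image: "finite (Q ` {a..b})"
proof (rule finite_subset)
  show "Q ` {a..b} \<subseteq> (\<lambda>(i, k). x i + of_int k) ` ({1..N} \<times> {\<lfloor>a\<rfloor>..\<lfloor>b\<rfloor>})"
  proof
    fix v assume "v \<in> Q ` {a..b}"
    then obtain u where u: "a \<le> u" "u \<le> b" "v = Q u" by auto
    obtain i where "i \<in> {1..N}" "Q u = x i + of_int \<lfloor>u\<rfloor>"
      using quantile_in by blast
    then show "v \<in> (\<lambda>(i, k). x i + of_int k) ` ({1..N} \<times> {\<lfloor>a\<rfloor>..\<lfloor>b\<rfloor>})"
      using u by (intro image_eqI[of _ _ "(i, \<lfloor>u\<rfloor>)"]) (auto intro: floor_mono)
  qed
qed simp

section \<open>Lifted points and potentials with drift\<close>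

abbreviation lifts :: "real set" where
  "lifts \<equiv> {x i + of_int k |i k. i \<in> {1..N}}"

lemma quantile_in_lifts: "Q u \<in> lifts"
  using quantile_in[of u] by blast

text \<open>The distinct atoms are sorted within one period and repeated by integer translation;
  \<open>K\<close> is their number.\<close>

lemma lifts_enumeration:
  obtains xi :: "int \<Rightarrow> real" and K :: int
  where "strict_mono xi" "range xi = lifts" "\<And>n. xi (n + K) = xi n + 1"
proof -
  define xs where "xs = sorted_list_of_set (x ` {1..N})"
  define K where "K = int (length xs)"
  define xi where "xi n = xs ! nat (n mod K) + of_int (n div K)" for n
  have set_xs: "set xs = x ` {1..N}"
    by (simp add: xs_def)
  have K: "0 < K"
    using set_xs N_pos by (cases xs) (auto simp: K_def)
  have sorted: "sorted_wrt (<) xs"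
    by (simp add: xs_def)
  have xs: "0 \<le> xs ! n" "xs ! n < 1" if "n < length xs" for n
    using set_xs nth_mem[OF that] x_ge_0 x_less_1 by auto
  have idx: "nat (n mod K) < length xs" for n
    using K by (simp add: K_def nat_less_iff)
  have step: "xi n < xi (n + 1)" for n
  proof (cases "n mod K + 1 < K")
    case True
    have 1: "(n + 1) mod K = n mod K + 1" "(n + 1) div K = n div K"
      using int_mod_pos_eq[of "n + 1" K "n div K" "n mod K + 1"] int_div_pos_eq[of "n + 1" K "n div K" "n mod K + 1"]
        True K by simp_all
    have "xs ! nat (n mod K) < xs ! nat (n mod K + 1)"
      using True K by (intro sorted_wrt_nth_less[OF sorted]) (auto simp: K_def nat_less_iff)
    then show ?thesis by (simp add: xi_def 1)
  next
    \<comment> \<open>Wrap-around: the last atom of a period is below 1 plus the first atom, since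
      all atoms lie in \<open>{0..<1}\<close>.\<close>
    case False
    then have m: "n mod K = K - 1"
      using pos_mod_bound[OF K, of n] by linarith
    have "n + 1 = (n div K + 1) * K"
      using div_mult_mod_eq[of n K] m by (simp add: algebra_simps)
    then have 1: "(n + 1) mod K = 0" "(n + 1) div K = n div K + 1"
      using K by simp_all
    show ?thesis
      using xs[OF idx[of n]] xs[OF idx[of "n + 1"]] by (simp add: xi_def 1)
  qed
  show ?thesis
  proof (rule that)
    show "strict_mono xi"
      by (rule strict_mono_int) (rule step)
    show "xi (n + K) = xi n + 1" for n
      using K by (simp add: xi_def)
    show "range xi = lifts"
    proof (intro equalityI subsetI)
      fix s assume "s \<in> range xi"
      then obtain n where "s = xi n" by blast
      moreover obtain i where "i \<in> {1..N}" "xs ! nat (n mod K) = x i"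
        using nth_mem[OF idx[of n]] set_xs by auto
      ultimately show "s \<in> lifts"
        unfolding xi_def by auto
    next
      fix s assume "s \<in> lifts"
      then obtain i k where s: "s = x i + of_int k" "i \<in> {1..N}" by blast
      then obtain m where m: "m < length xs" "xs ! m = x i"
        using set_xs by (metis imageI in_set_conv_nth)
      have "xi (int m + k * K) = s"
        using m K by (simp add: xi_def s K_def)
      then show "s \<in> range xi" by blast
    qed
  qed
qed

text \<open>The potential is summed along the enumeration of the lifts: its increment over the gap
  \<open>[xi n, xi (n + 1)]\<close> is that of \<open>s \<mapsto> H (s - b n)\<close>, where \<open>b n\<close> is the value of \<open>B\<close> at the mass level
  separating the two points. Monotonicity of \<open>B\<close> and convexity of \<open>H\<close> compare it with the increment
  of \<open>s \<mapsto> H (s - B u)\<close> on either side of \<open>Q u\<close>.\<close>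

lemma quasi_periodic_potential:
  fixes H B :: "real \<Rightarrow> real"
  assumes H: "convex_on UNIV H" and B: "mono B" and B_add: "\<And>u. B (u + 1) = B u + 1"
  obtains p :: "real \<Rightarrow> real" and \<kappa> :: real
  where "\<And>s k. s \<in> lifts \<Longrightarrow> p (s + of_int k) = p s + \<kappa> * of_int k"
    and "\<And>s u. s \<in> lifts \<Longrightarrow> p s - H (s - B u) \<le> p (Q u) - H (Q u - B u)"
proof -
  obtain xi :: "int \<Rightarrow> real" and K :: int
    where xi: "strict_mono xi" "range xi = lifts" and xi_K: "\<And>n. xi (n + K) = xi n + 1"
    by (rule lifts_enumeration) blast
  define b where "b n = B (F (xi (n + 1)))" for n
  define d where "d n = H (xi (n + 1) - b n) - H (xi n - b n)" for n
  obtain P where P: "\<And>n. P (n + 1) = P n + d n"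
    using int_antidifference[of d] by blast
  have d_K: "d (n + K) = d n" for n
  proof -
    have "xi (n + K + 1) = xi (n + 1) + 1"
      using xi_K[of "n + 1"] by (simp add: algebra_simps)
    then show ?thesis
      using B_add cdf_add_int[of "xi (n + 1)" 1] by (simp add: d_def b_def xi_K)
  qed
  \<comment> \<open>The drift is the total increment over one period; the
    \<open>K\<close>-periodicity of \<open>d\<close> makes it independent of the starting
    index.\<close>
  define \<kappa> where "\<kappa> = P K - P 0"
  have P_K: "P (n + K) = P n + \<kappa>" for n
  proof (induction n rule: int_induct[where k = 0])
    case base
    then show ?case by (simp add: \<kappa>_def)
  next
    case (step1 i)
    then show ?case using P[of i] P[of "i + K"] d_K[of i] by (simp add: algebra_simps)
  next
    case (step2 i)
    then show ?case using P[of "i - 1"] P[of "i - 1 + K"] d_K[of "i - 1"] by (simp add: algebra_simps)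
  qed
  have P_Kn: "P (n + k * K) = P n + \<kappa> * of_int k" for n k
  proof (induction k rule: int_induct[where k = 0])
    case base
    then show ?case by simp
  next
    case (step1 i)
    then show ?case using P_K[of "n + i * K"] by (simp add: algebra_simps)
  next
    case (step2 i)
    then show ?case using P_K[of "n + (i - 1) * K"] by (simp add: algebra_simps)
  qed
  have xi_Kn: "xi (n + k * K) = xi n + of_int k" for n k
  proof (induction k rule: int_induct[where k = 0])
    case base
    then show ?case by simp
  next
    case (step1 i)
    then show ?case using xi_K[of "n + i * K"] by (simp add: algebra_simps)
  next
    case (step2 i)
    then show ?case using xi_K[of "n + (i - 1) * K"] by (simp add: algebra_simps)
  qed
  have inj: "inj xi"
    using xi(1) by (rule strict_mono_imp_inj_on)
  \<comment> \<open>As a function of \<open>n\<close>, \<open>P n - H (xi n - B u)\<close> does not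
    decrease up to \<open>m\<close> and does not increase afterwards, so \<open>m\<close> is a
    maximiser.\<close>
  have main: "P n - H (xi n - B u) \<le> P m - H (xi m - B u)" if m: "Q u = xi m" for n m u
  proof -
    have up: "d l \<le> H (xi (l + 1) - B u) - H (xi l - B u)" if "m \<le> l" for l
    proof -
      have "xi m < xi (l + 1)"
        using that by (intro strict_monoD[OF xi(1)]) simp
      then have "B u \<le> b l"
        unfolding b_def using less_cdf_iff[of u] m by (intro monoD[OF B]) (simp add: less_imp_le)
      then show ?thesis
        unfolding d_def using strict_monoD[OF xi(1), of l "l + 1"]
        by (intro convex_increment_mono[OF H]) auto
    qed
    have down: "H (xi (l + 1) - B u) - H (xi l - B u) \<le> d l" if "l < m" for l
    proof -
      have "xi (l + 1) \<le> xi m"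
        using that by (intro monoD[OF strict_mono_mono[OF xi(1)]]) simp
      then have "b l \<le> B u"
        unfolding b_def using less_cdf_iff[of u "xi (l + 1)"] m by (intro monoD[OF B]) (simp add: not_less)
      then show ?thesis
        unfolding d_def using strict_monoD[OF xi(1), of l "l + 1"]
        by (intro convex_increment_mono[OF H]) auto
    qed
    show ?thesis
    proof (induction n rule: int_induct[where k = m])
      case base
      then show ?case by simp
    next
      case (step1 i)
      then show ?case using up[of i] P[of i] by simp
    next
      case (step2 i)
      then show ?case using down[of "i - 1"] P[of "i - 1"] by simp
    qed
  qed
  show ?thesis
  proof (rule that[of "\<lambda>s. P (inv xi s)" \<kappa>])
    fix s assume "s \<in> lifts"
    then obtain n where s: "s = xi n"
      using xi(2) by (metis imageE)
    show "P (inv xi (s + of_int k)) = P (inv xi s) + \<kappa> * of_int k" for k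
      unfolding s xi_Kn[symmetric] by (simp add: inj P_Kn)
    fix u
    obtain m where m: "Q u = xi m"
      using xi(2) quantile_in_lifts by (metis imageE)
    show "P (inv xi s) - H (s - B u) \<le> P (inv xi (Q u)) - H (Q u - B u)"
      unfolding s m using main[OF m, of n] m by (simp add: inj)
  qed
qed

section \<open>Shifted quantiles and the splitting of atoms\<close>

lemma mono_quantile: "mono Q"
  by (simp add: mono_def quantile_mono)

text \<open>\<open>p\<close> composed with \<open>Q\<close> inherits the drift \<open>k\<close>, so
  the shift of the parameter costs \<open>k * a\<close>. Shares use \<open>k = 0\<close>; the
  potential on the second distribution uses the negative drift.\<close>

lemma has_integral_shifted_quantile:
  assumes "\<And>u. p (Q u + 1) = p (Q u) + k"
  shows "((\<lambda>u. p (Q (u + a))) has_integral ((\<Sum>i=1..N. f i * p (x i)) + k * a)) {0..1}"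
proof (rule has_integral_shift_quasi_periodic)
  show "p (Q (u + 1)) = p (Q u) + k" for u
    using assms quantile_add_int[of u 1] by simp
  show "(\<lambda>u. p (Q u)) integrable_on {s..t}" for s t
    using integrable_mono_step[OF mono_quantile finite_quantile_image mono_quantile finite_quantile_image, where p = "\<lambda>s _. p s"] .
qed (rule has_integral_quantile)

text \<open>The points \<open>x i\<close> need not be distinct: the mass at an atom is split among its indices in
  proportion to \<open>f\<close>.\<close>

definition share :: "nat \<Rightarrow> real \<Rightarrow> real" where
  "share i s = (if frac s = x i then f i / (\<Sum>j\<in>{j\<in>{1..N}. x j = x i}. f j) else 0)"

lemma atom_pos: "i \<in> {1..N} \<Longrightarrow> 0 < (\<Sum>j\<in>{j\<in>{1..N}. x j = x i}. f j)"
  by (intro sum_pos2[of _ i]) (auto simp: f_pos f_nonneg)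

lemma share_nonneg: "i \<in> {1..N} \<Longrightarrow> 0 \<le> share i s"
  using atom_pos[of i] f_nonneg[of i] by (simp add: share_def)

lemma frac_lift: "i \<in> {1..N} \<Longrightarrow> frac (x i + of_int k) = x i"
  using x_ge_0[of i] x_less_1[of i] by (simp add: frac_eq)

lemma sum_share: "(\<Sum>i=1..N. share i (Q u)) = 1"
proof -
  obtain j where j: "j \<in> {1..N}" "Q u = x j + of_int \<lfloor>u\<rfloor>"
    using quantile_in by blast
  have "(\<Sum>i=1..N. share i (Q u)) = (\<Sum>i=1..N. if x i = x j then f i / (\<Sum>l\<in>{l\<in>{1..N}. x l = x j}. f l) else 0)"
    using j frac_lift[OF j(1), of 0] by (intro sum.cong) (auto simp: share_def frac_lift)
  also have "\<dots> = (\<Sum>i\<in>{i\<in>{1..N}. x i = x j}. f i / (\<Sum>l\<in>{l\<in>{1..N}. x l = x j}. f l))"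
    by (rule sum.inter_filter[symmetric]) simp
  also have "\<dots> = 1"
    using atom_pos[OF j(1)] by (simp flip: sum_divide_distrib)
  finally show ?thesis .
qed

text \<open>\<open>share i\<close> has period 1, so the shift has no effect, and the proportions at
  the atom cancel its total mass.\<close>

lemma integral_share:
  assumes i: "i \<in> {1..N}"
  shows "((\<lambda>u. share i (Q (u + a))) has_integral f i) {0..1}"
proof -
  have "(\<Sum>j=1..N. f j * share i (x j)) = (\<Sum>j=1..N. if x j = x i then f j * (f i / (\<Sum>l\<in>{l\<in>{1..N}. x l = x i}. f l)) else 0)"
    using frac_lift[of _ 0] by (intro sum.cong) (auto simp: share_def)
  also have "\<dots> = (\<Sum>j\<in>{j\<in>{1..N}. x j = x i}. f j * (f i / (\<Sum>l\<in>{l\<in>{1..N}. x l = x i}. f l)))"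
    by (rule sum.inter_filter[symmetric]) simp
  also have "\<dots> = f i"
    using atom_pos[OF i] unfolding sum_distrib_right[symmetric] by simp
  finally have "(\<Sum>j=1..N. f j * share i (x j)) = f i" .
  moreover have "share i (s + 1) = share i s" for s
    by (simp add: share_def frac_def)
  ultimately show ?thesis
    using has_integral_shifted_quantile[of "share i" 0 a] by simp
qed

end

section \<open>Couplings of two distributions\<close>

locale circle_transport =
  X: circle_distribution N x f + Y: circle_distribution M y g
  for N x f M y g
begin

text \<open>This is weak duality for the lifted problem, with arbitrary windings
  \<open>k i j\<close>; the specific choice realising the circle distance is made only in the
  theorem.\<close>

lemma monotone_coupling_le:
  fixes H :: "real \<Rightarrow> real" and k :: "nat \<Rightarrow> nat \<Rightarrow> int"
  assumes H: "convex_on UNIV H" and a: "a \<in> transport_plans N f M g"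
  defines "\<alpha> \<equiv> \<Sum>i=1..N. \<Sum>j=1..M. a i j * of_int (k i j)"
  shows "integral {0..1} (\<lambda>u. H (X.Q u - Y.Q (u + \<alpha>)))
    \<le> (\<Sum>i=1..N. \<Sum>j=1..M. a i j * H (x i - (y j + of_int (k i j))))"
proof -
  define B where "B u = Y.Q (u + \<alpha>)" for u
  have mono_B: "mono B"
    by (auto simp: B_def mono_def intro: Y.quantile_mono)
  have B_add: "B (u + of_int n) = B u + of_int n" for u n
  proof -
    have "B (u + of_int n) = Y.Q (u + \<alpha> + of_int n)"
      unfolding B_def by (rule arg_cong[of _ _ Y.Q]) simp
    then show ?thesis
      by (simp only: Y.quantile_add_int B_def)
  qed
  have B_add1: "B (u + 1) = B u + 1" for u
    using B_add[of u 1] by simp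
  obtain p \<kappa> where p_add: "\<And>s n. s \<in> X.lifts \<Longrightarrow> p (s + of_int n) = p s + \<kappa> * of_int n"
    and p_le: "\<And>s u. s \<in> X.lifts \<Longrightarrow> p s - H (s - B u) \<le> p (X.Q u) - H (X.Q u - B u)"
    by (rule X.quasi_periodic_potential[OF H mono_B B_add1]) blast
  \<comment> \<open>Any preimage of \<open>t\<close> under \<open>B\<close> gives the same value of \<open>q t\<close>, by \<open>p_le\<close> used both ways.\<close>
  define v where "v t = (SOME u. B u = t)" for t
  define q where "q t = H (X.Q (v t) - t) - p (X.Q (v t))" for t
  have q_B: "q (B u) = H (X.Q u - B u) - p (X.Q u)" for u
  proof -
    have "B (v (B u)) = B u"
      unfolding v_def by (rule someI) (rule refl)
    then show ?thesis
      using p_le[OF X.quantile_in_lifts, of "v (B u)" u] p_le[OF X.quantile_in_lifts, of u "v (B u)"]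
      by (simp add: q_def)
  qed
  \<comment> \<open>A common translation of both arguments leaves \<open>H (s - t)\<close>
    unchanged, so \<open>q\<close> drifts oppositely to \<open>p\<close>.\<close>
  have q_add: "q (B u + of_int n) = q (B u) - \<kappa> * of_int n" for u n
    using q_B[of u] q_B[of "u + of_int n"] p_add[OF X.quantile_in_lifts, of u n]
    by (simp add: B_add X.quantile_add_int)
  have B_surj: "\<exists>u. y j + of_int n = B u" if j: "j \<in> {1..M}" for j n
  proof -
    obtain u where "Y.Q u = y j + of_int n"
      using Y.quantile_surj[OF j] by blast
    then have "y j + of_int n = B (u - \<alpha>)"
      by (simp add: B_def)
    then show ?thesis ..
  qed
  \<comment> \<open>The maximality in \<open>p_le\<close> is applied at a level \<open>w\<close>
    where \<open>B w\<close> is the lifted target point.\<close>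
  have dual: "p (x i) + (q (y j) - \<kappa> * of_int n) \<le> H (x i - (y j + of_int n))"
    if i: "i \<in> {1..N}" and j: "j \<in> {1..M}" for i j n
  proof -
    obtain u where u: "y j = B u"
      using B_surj[OF j, of 0] by auto
    obtain w where w: "y j + of_int n = B w"
      using B_surj[OF j, of n] by auto
    have "x i \<in> X.lifts"
      using i by (intro CollectI exI[of _ i] exI[of _ 0]) simp
    from p_le[OF this, of w] show ?thesis
      using q_B[of w] q_add[of u n] by (simp flip: u w)
  qed
  have "((\<lambda>u. p (X.Q u) + q (Y.Q (u + \<alpha>))) has_integral
      (\<Sum>i=1..N. f i * p (x i)) + ((\<Sum>j=1..M. g j * q (y j)) + - \<kappa> * \<alpha>)) {0..1}"
  proof (intro has_integral_add X.has_integral_quantile Y.has_integral_shifted_quantile)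
    show "q (Y.Q u + 1) = q (Y.Q u) + - \<kappa>" for u
      using q_add[of "u - \<alpha>" 1] by (simp add: B_def)
  qed
  then have "integral {0..1} (\<lambda>u. H (X.Q u - Y.Q (u + \<alpha>)))
      = (\<Sum>i=1..N. f i * p (x i)) + ((\<Sum>j=1..M. g j * q (y j)) + - \<kappa> * \<alpha>)"
    using q_B by (simp add: B_def integral_unique)
  also have "(\<Sum>i=1..N. f i * p (x i)) = (\<Sum>i=1..N. \<Sum>j=1..M. a i j * p (x i))"
    using a by (intro sum.cong) (auto simp: transport_plans_def simp flip: sum_distrib_right)
  also have "(\<Sum>j=1..M. g j * q (y j)) = (\<Sum>i=1..N. \<Sum>j=1..M. a i j * q (y j))"
    using a by (subst sum.swap, intro sum.cong) (auto simp: transport_plans_def simp flip: sum_distrib_right)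
  \<comment> \<open>The value of \<open>\<alpha>\<close> enters here:
    \<open>\<kappa> * \<alpha>\<close> is the average of \<open>\<kappa> * k i j\<close> under the
    plan.\<close>
  also have "(\<Sum>i=1..N. \<Sum>j=1..M. a i j * p (x i)) + ((\<Sum>i=1..N. \<Sum>j=1..M. a i j * q (y j)) + - \<kappa> * \<alpha>)
      = (\<Sum>i=1..N. \<Sum>j=1..M. a i j * (p (x i) + (q (y j) - \<kappa> * of_int (k i j))))"
    by (simp add: \<alpha>_def sum_distrib_left sum.distrib sum_subtractf sum_negf algebra_simps)
  also have "\<dots> \<le> (\<Sum>i=1..N. \<Sum>j=1..M. a i j * H (x i - (y j + of_int (k i j))))"
    using a dual by (intro sum_mono mult_left_mono) (auto simp: transport_plans_def)
  finally show ?thesis .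
qed

text \<open>Projecting coupled quantiles to the circle does not increase their distance, so
  monotonicity of \<open>h\<close> bounds the cost.\<close>

lemma coupling_plan:
  assumes h: "mono h"
    and c: "\<And>s t. s \<in> {0..<1} \<Longrightarrow> t \<in> {0..<1} \<Longrightarrow> c s t = h (circle_dist s t)"
  obtains a where "a \<in> transport_plans N f M g"
    "transport_cost c N x M y a \<le> integral {0..1} (\<lambda>u. h \<bar>X.Q u - Y.Q (u + \<alpha>)\<bar>)"
proof -
  define B where "B u = Y.Q (u + \<alpha>)" for u
  have mono_B: "mono B"
    by (auto simp: B_def mono_def intro: Y.quantile_mono)
  have fin_B: "finite (B ` {s..t})" for s t
    by (rule finite_subset[OF _ Y.finite_quantile_image[of "s + \<alpha>" "t + \<alpha>"]]) (auto simp: B_def)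
  have int: "(\<lambda>u. r (X.Q u) (B u)) integrable_on {0..1}" for r :: "real \<Rightarrow> real \<Rightarrow> real"
    by (intro integrable_mono_step X.mono_quantile X.finite_quantile_image mono_B fin_B)
  \<comment> \<open>\<open>a\<close> is the joint law of the projected quantiles, each atom being
    divided among its indices.\<close>
  define a where "a i j = integral {0..1} (\<lambda>u. X.share i (X.Q u) * Y.share j (B u))" for i j
  note int_share = int[of "\<lambda>s t. X.share i s * Y.share j t" for i j]
  have "a \<in> transport_plans N f M g"
    unfolding transport_plans_def
  proof (intro CollectI conjI ballI)
    fix i j assume i: "i \<in> {1..N}" and j: "j \<in> {1..M}"
    show "0 \<le> a i j"
      unfolding a_def using i j
      by (intro integral_nonneg int_share) (simp add: X.share_nonneg Y.share_nonneg)
  next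
    fix j assume j: "j \<in> {1..M}"
    have "(\<Sum>i=1..N. a i j) = integral {0..1} (\<lambda>u. \<Sum>i=1..N. X.share i (X.Q u) * Y.share j (B u))"
      unfolding a_def by (intro integral_sum[symmetric] int_share) simp
    also have "\<dots> = integral {0..1} (\<lambda>u. Y.share j (B u))"
      by (simp only: sum_distrib_right[symmetric] X.sum_share mult_1_left)
    also have "\<dots> = g j"
      unfolding B_def by (rule integral_unique[OF Y.integral_share[OF j]])
    finally show "(\<Sum>i=1..N. a i j) = g j" .
  next
    fix i assume i: "i \<in> {1..N}"
    have "(\<Sum>j=1..M. a i j) = integral {0..1} (\<lambda>u. \<Sum>j=1..M. X.share i (X.Q u) * Y.share j (B u))"
      unfolding a_def by (intro integral_sum[symmetric] int_share) simp
    also have "\<dots> = integral {0..1} (\<lambda>u. X.share i (X.Q u))"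
      by (simp only: B_def sum_distrib_left[symmetric] Y.sum_share mult_1_right)
    also have "\<dots> = f i"
      using integral_unique[OF X.integral_share[OF i, of 0]] by simp
    finally show "(\<Sum>j=1..M. a i j) = f i" .
  qed
  moreover have "transport_cost c N x M y a \<le> integral {0..1} (\<lambda>u. h \<bar>X.Q u - B u\<bar>)"
  proof -
    have "transport_cost c N x M y a
        = (\<Sum>i=1..N. \<Sum>j=1..M. integral {0..1} (\<lambda>u. X.share i (X.Q u) * Y.share j (B u) * c (x i) (y j)))"
      by (simp add: transport_cost_def a_def)
    also have "\<dots> = integral {0..1} (\<lambda>u. \<Sum>i=1..N. \<Sum>j=1..M. X.share i (X.Q u) * Y.share j (B u) * c (x i) (y j))"
      by (simp add: integral_sum integrable_sum int_share integrable_on_mult_left)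
    also have "\<dots> = integral {0..1} (\<lambda>u. c (frac (X.Q u)) (frac (B u)))"
    proof (rule Henstock_Kurzweil_Integration.integral_cong)
      fix u
      \<comment> \<open>Where both shares are nonzero, \<open>x i\<close> and \<open>y j\<close> are
        the projections of the two quantiles, so the cost factors out of the sums.\<close>
      have "(\<Sum>i=1..N. \<Sum>j=1..M. X.share i (X.Q u) * Y.share j (B u) * c (x i) (y j))
          = (\<Sum>i=1..N. \<Sum>j=1..M. X.share i (X.Q u) * Y.share j (B u) * c (frac (X.Q u)) (frac (B u)))"
        by (intro sum.cong refl) (auto simp: X.share_def Y.share_def)
      also have "\<dots> = (\<Sum>i=1..N. X.share i (X.Q u)) * (\<Sum>j=1..M. Y.share j (B u)) * c (frac (X.Q u)) (frac (B u))"
        by (simp only: sum_distrib_right[symmetric] sum_distrib_left[symmetric])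
      also have "\<dots> = c (frac (X.Q u)) (frac (B u))"
        unfolding B_def X.sum_share Y.sum_share by simp
      finally show "(\<Sum>i=1..N. \<Sum>j=1..M. X.share i (X.Q u) * Y.share j (B u) * c (x i) (y j)) = \<dots>" .
    qed
    also have "\<dots> \<le> integral {0..1} (\<lambda>u. h \<bar>X.Q u - B u\<bar>)"
    proof (rule integral_le)
      show "(\<lambda>u. c (frac (X.Q u)) (frac (B u))) integrable_on {0..1}"
        by (rule int[of "\<lambda>s t. c (frac s) (frac t)"])
      show "(\<lambda>u. h \<bar>X.Q u - B u\<bar>) integrable_on {0..1}"
        by (rule int[of "\<lambda>s t. h \<bar>s - t\<bar>"])
      show "c (frac (X.Q u)) (frac (B u)) \<le> h \<bar>X.Q u - B u\<bar>" for u
        using monoD[OF h circle_dist_frac_le[of "X.Q u" "B u"]] by (simp add: c frac_lt_1)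
    qed
    finally show ?thesis .
  qed
  ultimately show ?thesis
    using that unfolding B_def by blast
qed

end

section \<open>Equality of the optimal cost and the infimum\<close>

lemma pseudo_inverse_shift: "pseudo_inverse (\<lambda>t. G t - \<alpha>) u = pseudo_inverse G (u + \<alpha>)"
  by (simp add: pseudo_inverse_def less_diff_eq)

theorem theorem1:
  fixes h :: "real \<Rightarrow> real" and c :: "real \<Rightarrow> real \<Rightarrow> real"
    and N M :: nat and x f y g :: "nat \<Rightarrow> real"
  assumes h_nonneg: "\<And>t. h t \<ge> 0"
    and h_mono: "mono h"
    and h_convex: "convex_on UNIV h"
    and c_h: "\<And>s t. s \<in> {0..<1} \<Longrightarrow> t \<in> {0..<1} \<Longrightarrow> c s t = h (circle_dist s t)"
    and f: "discrete_distribution N x f"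
    and g: "discrete_distribution M y g"
  shows "MK c N x f M y g =
    (INF \<alpha>::real. integral {0..1}
       (\<lambda>u. h \<bar>pseudo_inverse (circle_cdf N x f) u
               - pseudo_inverse (\<lambda>t. circle_cdf M y g t - \<alpha>) u\<bar>))"
proof -
  interpret circle_transport N x f M y g
    using f g by unfold_locales
  define J where "J \<alpha> = integral {0..1} (\<lambda>u. h \<bar>X.Q u - Y.Q (u + \<alpha>)\<bar>)" for \<alpha>
  obtain a where a: "a \<in> transport_plans N f M g"
    and a_min: "\<And>b. b \<in> transport_plans N f M g \<Longrightarrow> transport_cost c N x M y a \<le> transport_cost c N x M y b"
    using transport_cost_attains_min[OF f g] by blast
  have "MK c N x f M y g = transport_cost c N x M y a"
    unfolding MK_def using a a_min by (intro Least_equality) auto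
  have a_le: "transport_cost c N x M y a \<le> J \<alpha>" for \<alpha>
  proof -
    obtain b where "b \<in> transport_plans N f M g" "transport_cost c N x M y b \<le> J \<alpha>"
      unfolding J_def using coupling_plan[OF h_mono c_h] by blast
    then show ?thesis
      using a_min by fastforce
  qed
  \<comment> \<open>Lifting along shortest arcs makes the lifted cost of the optimal plan equal to
    its circle cost.\<close>
  have "\<exists>k::int. circle_dist (x i) (y j) = \<bar>x i - (y j + of_int k)\<bar>"
    if "i \<in> {1..N}" "j \<in> {1..M}" for i j
  proof -
    have "x i \<in> {0..<1}" "y j \<in> {0..<1}"
      using that X.x_ge_0 X.x_less_1 Y.x_ge_0 Y.x_less_1 by auto
    then show ?thesis
      using circle_dist_lift by metis
  qed
  then obtain k :: "nat \<Rightarrow> nat \<Rightarrow> int" where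
    k: "\<And>i j. i \<in> {1..N} \<Longrightarrow> j \<in> {1..M} \<Longrightarrow> circle_dist (x i) (y j) = \<bar>x i - (y j + of_int (k i j))\<bar>"
    by metis
  define \<alpha> where "\<alpha> = (\<Sum>i=1..N. \<Sum>j=1..M. a i j * of_int (k i j))"
  have "J \<alpha> \<le> (\<Sum>i=1..N. \<Sum>j=1..M. a i j * h \<bar>x i - (y j + of_int (k i j))\<bar>)"
    unfolding J_def \<alpha>_def
    by (rule monotone_coupling_le[OF convex_on_mono_abs[OF h_mono h_convex] a])
  also have "\<dots> = transport_cost c N x M y a"
    unfolding transport_cost_def
    by (intro sum.cong refl) (simp add: c_h k X.x_ge_0 X.x_less_1 Y.x_ge_0 Y.x_less_1)
  finally have "J \<alpha> = transport_cost c N x M y a"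
    using a_le[of \<alpha>] by simp
  \<comment> \<open>The mean winding of an optimal plan attains the infimum, since the optimal cost
    is a lower bound for every \<open>J\<close>.\<close>
  then have "(INF \<alpha>. J \<alpha>) = transport_cost c N x M y a"
    using a_le by (intro cInf_eq_minimum) (auto simp: image_iff intro!: exI[of _ \<alpha>])
  then show ?thesis
    using \<open>MK c N x f M y g = _\<close> by (simp add: J_def pseudo_inverse_shift)
qed

end
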